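(* Let $n\ge 9$ and let $B\in\mathcal{G}(n)\setminus\{(0,0),(n,n)\}$. Put $$\mathcal{S}=\{(1,2),(2,1),(n-1,n-2),(n-2,n-1)\},$$ $$\mathcal{C}=\{(1,0),(0,1),(1,1),(n-1,n),(n,n-1),(n-1,n-1)\}.$$ Then the maximum of $f_B(A)$ over all $A\in\mathcal{G}(n)\setminus\{(0,0),(n,n)\}$ is attained at one of the ten points of $\mathcal{S}\cup\mathcal{C}$. More precisely: (i) if $B=(c,d)\in\mathcal{S}$, then the maximum is attained at $(d,c)$, the reflection of $B$ across the diagonal $y=x$; (ii) if $B\notin\mathcal{S}$, then the maximum is attained at a point of $\mathcal{C}$. In other words, the points of $\mathcal{S}$ are exactly the obstructions $B$ for which the maximum is not attained at any point of $\mathcal{C}$.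
   Context: For $n\in\mathbb{N}$, $\mathcal{G}(n)=\{(x,y)\in\mathbb{Z}^2: 0\le x\le n,\ 0\le y\le n\}$, and $\mathcal{P}_n$ is the set of lattice paths from $(0,0)$ to $(n,n)$ using only unit east steps $(1,0)$ and unit north steps $(0,1)$. For $A,B\in\mathcal{G}(n)$ with $B\notin\{(0,0),(n,n)\}$, $f_B(A)$ denotes the number of paths $p\in\mathcal{P}_n$ that pass through $A$ and do not pass through $B$ (so $f_B(B)=0$). *)

theory Defs
  imports Main
begin

definition grid :: "nat \<Rightarrow> (int \<times> int) set" where
  "grid n = {(x, y). 0 \<le> x \<and> x \<le> int n \<and> 0 \<le> y \<and> y \<le> int n}"

definition inner_grid :: "nat \<Rightarrow> (int \<times> int) set" where
  "inner_grid n = grid n - {(0, 0), (int n, int n)}"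

definition unit_step :: "int \<times> int \<Rightarrow> int \<times> int \<Rightarrow> bool" where
  "unit_step P Q \<longleftrightarrow> Q = (fst P + 1, snd P) \<or> Q = (fst P, snd P + 1)"

text \<open>A path is the list of lattice points it visits, in order, both end points included; so a
  path \<open>p\<close> passes through \<open>A\<close> iff \<open>A \<in> set p\<close>.\<close>

definition lattice_paths :: "nat \<Rightarrow> (int \<times> int) list set" where
  "lattice_paths n =
     {p. p \<noteq> [] \<and> hd p = (0, 0) \<and> last p = (int n, int n) \<and> successively unit_step p}"

definition avoid_count :: "nat \<Rightarrow> int \<times> int \<Rightarrow> int \<times> int \<Rightarrow> nat" where
  "avoid_count n B A = card {p \<in> lattice_paths n. A \<in> set p \<and> B \<notin> set p}"

definition max_attained_at :: "nat \<Rightarrow> int \<times> int \<Rightarrow> int \<times> int \<Rightarrow> bool" where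
  "max_attained_at n B A \<longleftrightarrow>
     A \<in> inner_grid n \<and> avoid_count n B A = Max (avoid_count n B ` inner_grid n)"

definition special_points :: "nat \<Rightarrow> (int \<times> int) set" where
  "special_points n =
     {(1, 2), (2, 1), (int n - 1, int n - 2), (int n - 2, int n - 1)}"

definition corner_points :: "nat \<Rightarrow> (int \<times> int) set" where
  "corner_points n =
     {(1, 0), (0, 1), (1, 1), (int n - 1, int n), (int n, int n - 1), (int n - 1, int n - 1)}"

end

theory Submission
  imports Defs Complex_Main
begin

text \<open>
  Write \<open>g(P)\<close> for the number of paths from \<open>P\<close> to \<open>(n, n)\<close> that avoid \<open>B\<close>, and call
  \<open>x + y\<close> the level of \<open>(x, y)\<close>. Below the level of \<open>B\<close>, \<open>g\<close> satisfies Pascal's recurrence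
  \<open>g(i, j) = g(i + 1, j) + g(i, j + 1)\<close>. Hence \<open>g\<close> at any point is a binomially weighted sum of
  its values on a higher level (\<open>pascal_expansion\<close>), and for \<open>A = (a, b)\<close> not above the level
  of \<open>B\<close> the quantity to be maximised is \<open>(a + b choose a) * g(A)\<close> (\<open>avoid_count_eq\<close>).
  Rotation by 180 degrees reduces to that case and reflection to \<open>b \<le> a\<close>.

  The engine is the inequality \<open>g(a, b) \<le> g(a + 1, b - 1) + g(a - 1, b + 1)\<close>, valid as soon as
  none of the three points is \<open>B\<close> (\<open>avoid_from_neighbours\<close>): a path from \<open>A\<close> starts with a step
  to a point that is also one step away from one of the two neighbours. Expanding \<open>g(1, 0)\<close>,
  or \<open>g(1, 1)\<close> if \<open>a = b\<close>, on the level of \<open>A\<close> and keeping only the three terms at \<open>A\<close> and its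
  neighbours, the inequality shows that the corner \<open>(1, 0)\<close>, respectively \<open>(1, 1)\<close>, is at least
  as good as \<open>A\<close>. Obstructions other than the two neighbours of \<open>A\<close> are thereby settled,
  whatever their position, except that \<open>A\<close> must have positive coordinates; but every path through
  \<open>(a, 0)\<close> passes through \<open>(1, 0)\<close> anyway.

  There remain the \<open>B\<close> diagonally adjacent to \<open>A\<close>. If \<open>A\<close>, its reflection \<open>A'\<close> and \<open>B\<close> are
  three different points, they lie on one level, and counting the disjoint families of paths
  through them shows that \<open>(1, 0)\<close> or \<open>(0, 1)\<close> is at least as good as \<open>A\<close>
  (\<open>mirrored_pair_bound\<close>). The two remaining configurations, \<open>A = A'\<close> and \<open>A' = B\<close>, both come
  down to the single estimate \<open>central_binomial_product\<close>, which requires \<open>n \<ge> 9\<close> and \<open>k \<ge> 2\<close>.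
  For smaller \<open>k\<close> the point \<open>A\<close> is itself a corner, except, up to symmetry, when \<open>B = (1, 2)\<close>
  and \<open>A = (2, 1)\<close>. There an exact computation shows that \<open>A\<close> beats all six corners (\<open>corner_less_mirror\<close>),
  which makes the special points precisely the exceptions.
\<close>

section \<open>Counting paths level by level\<close>

definition paths_from :: "nat \<Rightarrow> int \<times> int \<Rightarrow> (int \<times> int) list set" where
  "paths_from n P =
     {p. p \<noteq> [] \<and> hd p = P \<and> last p = (int n, int n) \<and> successively unit_step p}"

definition count_from :: "nat \<Rightarrow> int \<times> int \<Rightarrow> nat" where
  "count_from n P = card (paths_from n P)"

definition avoid_from :: "nat \<Rightarrow> int \<times> int \<Rightarrow> int \<times> int \<Rightarrow> nat" where
  "avoid_from n B P = card {p \<in> paths_from n P. B \<notin> set p}"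

definition level :: "int \<times> int \<Rightarrow> int" where
  "level P = fst P + snd P"

lemma level_Pair [simp]: "level (i, j) = i + j"
  by (simp add: level_def)

lemma path_level_gt:
  assumes "successively unit_step (P # p)" "Q \<in> set p"
  shows "level P < level Q"
  using assms
proof (induction p arbitrary: P)
  case (Cons R p)
  have "level P < level R"
    using Cons.prems(1) by (auto simp: unit_step_def level_def)
  moreover have "Q = R \<or> level R < level Q"
    using Cons.IH[of R] Cons.prems by auto
  ultimately show ?case by auto
qed simp

lemma paths_from_levels:
  assumes "p \<in> paths_from n P" "Q \<in> set p"
  shows "Q = P \<or> level P < level Q"
proof -
  obtain q where "p = P # q"
    using assms(1) by (cases p) (auto simp: paths_from_def)
  then show ?thesis
    using assms path_level_gt[of P q Q] by (auto simp: paths_from_def)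
qed

lemma paths_from_above:
  assumes "level P \<ge> 2 * int n" "P \<noteq> (int n, int n)"
  shows "paths_from n P = {}"
proof -
  have False if "p \<in> paths_from n P" for p
  proof -
    have "(int n, int n) \<in> set p"
      using that last_in_set by (fastforce simp: paths_from_def)
    then show False
      using paths_from_levels[OF that] assms by fastforce
  qed
  then show ?thesis by blast
qed

lemma paths_from_end: "paths_from n (int n, int n) = {[(int n, int n)]}"
proof -
  have "p = [(int n, int n)]" if p: "p \<in> paths_from n (int n, int n)" for p
  proof (cases p)
    case (Cons P q)
    have "P = (int n, int n)" using p Cons by (simp add: paths_from_def)
    moreover have "q = []"
    proof (rule ccontr)
      assume "q \<noteq> []"
      then have "(int n, int n) \<in> set q"
        using p Cons last_in_set[of q] by (simp add: paths_from_def)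
      then show False
        using path_level_gt[of P q P] p Cons \<open>P = _\<close> by (simp add: paths_from_def)
    qed
    ultimately show ?thesis using Cons by simp
  qed (use p in \<open>simp add: paths_from_def\<close>)
  then show ?thesis by (auto simp: paths_from_def)
qed

lemma paths_from_step:
  assumes "(i, j) \<noteq> (int n, int n)"
  shows "paths_from n (i, j) =
           (#) (i, j) ` (paths_from n (i + 1, j) \<union> paths_from n (i, j + 1))"
proof (intro equalityI subsetI)
  fix p assume p: "p \<in> paths_from n (i, j)"
  then obtain q where q: "p = (i, j) # q"
    by (cases p) (auto simp: paths_from_def)
  with p assms have "q \<noteq> []" by (auto simp: paths_from_def)
  then obtain R r where "q = R # r" by (cases q) auto
  with p q have "q \<in> paths_from n (i + 1, j) \<union> paths_from n (i, j + 1)"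
    by (auto simp: paths_from_def unit_step_def)
  with q show "p \<in> (#) (i, j) ` (paths_from n (i + 1, j) \<union> paths_from n (i, j + 1))"
    by blast
next
  fix p assume "p \<in> (#) (i, j) ` (paths_from n (i + 1, j) \<union> paths_from n (i, j + 1))"
  then obtain q where "p = (i, j) # q" "q \<in> paths_from n (i + 1, j) \<union> paths_from n (i, j + 1)"
    by blast
  then show "p \<in> paths_from n (i, j)"
    by (cases q) (auto simp: paths_from_def unit_step_def)
qed

lemma finite_paths_from: "finite (paths_from n P)"
proof (induction "nat (2 * int n - level P)" arbitrary: P rule: less_induct)
  case less
  show ?case
  proof (cases "P = (int n, int n) \<or> level P \<ge> 2 * int n")
    case True
    then show ?thesis using paths_from_end paths_from_above by (metis finite.simps)
  next
    case False
    obtain i j where "P = (i, j)" by fastforce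
    then show ?thesis
      using False less paths_from_step[of i j n] by simp
  qed
qed

lemma card_paths_step:
  assumes "(i, j) \<noteq> (int n, int n)"
  shows "card {p \<in> paths_from n (i, j). \<Phi> p} =
           card {p \<in> paths_from n (i + 1, j). \<Phi> ((i, j) # p)} +
           card {p \<in> paths_from n (i, j + 1). \<Phi> ((i, j) # p)}"
proof -
  let ?X = "{p \<in> paths_from n (i + 1, j). \<Phi> ((i, j) # p)}"
  let ?Y = "{p \<in> paths_from n (i, j + 1). \<Phi> ((i, j) # p)}"
  have "{p \<in> paths_from n (i, j). \<Phi> p} = (#) (i, j) ` (?X \<union> ?Y)"
    unfolding paths_from_step[OF assms] by blast
  moreover have "?X \<inter> ?Y = {}" by (auto simp: paths_from_def)
  ultimately show ?thesis
    by (simp add: card_image card_Un_disjoint finite_paths_from)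
qed

text \<open>The weight \<open>m choose k\<close> is the number of ways of reaching the \<open>k\<close>-th point \<open>m\<close> levels
  higher. The recurrence is required only below level \<open>L\<close> because it breaks down at the
  obstruction and at the end point.\<close>

lemma pascal_expansion:
  fixes F :: "int \<Rightarrow> int \<Rightarrow> nat"
  assumes rec: "\<And>i j. i + j < L \<Longrightarrow> F i j = F (i + 1) j + F i (j + 1)"
    and "i + j + int m \<le> L"
  shows "F i j = (\<Sum>k\<le>m. (m choose k) * F (i + int k) (j + int m - int k))"
  using assms(2)
proof (induction m arbitrary: i j)
  case (Suc m)
  let ?H = "\<lambda>k. F (i + int k) (j + int (Suc m) - int k)"
  have "F i j = F (i + 1) j + F i (j + 1)"
    using Suc.prems by (intro rec) simp
  also have "\<dots> = (\<Sum>k\<le>m. (m choose k) * ?H (Suc k)) + (\<Sum>k\<le>m. (m choose k) * ?H k)"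
    using Suc.IH[of "i + 1" j] Suc.IH[of i "j + 1"] Suc.prems by (simp add: algebra_simps)
  also have "(\<Sum>k\<le>m. (m choose k) * ?H k) = (\<Sum>k\<le>Suc m. (m choose k) * ?H k)"
    by simp
  also have "\<dots> = ?H 0 + (\<Sum>k\<le>m. (m choose Suc k) * ?H (Suc k))"
    by (simp add: sum.atMost_Suc_shift del: sum.atMost_Suc)
  also have "(\<Sum>k\<le>m. (m choose k) * ?H (Suc k)) + \<dots> =
      ?H 0 + (\<Sum>k\<le>m. (Suc m choose Suc k) * ?H (Suc k))"
    by (simp add: sum.distrib algebra_simps)
  also have "\<dots> = (\<Sum>k\<le>Suc m. (Suc m choose k) * ?H k)"
    by (simp add: sum.atMost_Suc_shift del: sum.atMost_Suc)
  finally show ?case .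
qed simp

lemma count_from_step:
  "(i, j) \<noteq> (int n, int n) \<Longrightarrow>
     count_from n (i, j) = count_from n (i + 1, j) + count_from n (i, j + 1)"
  unfolding count_from_def using card_paths_step[of i j n "\<lambda>_. True"] by simp

lemma avoid_from_step:
  "(i, j) \<noteq> (int n, int n) \<Longrightarrow> (i, j) \<noteq> B \<Longrightarrow>
     avoid_from n B (i, j) = avoid_from n B (i + 1, j) + avoid_from n B (i, j + 1)"
  unfolding avoid_from_def using card_paths_step[of i j n "\<lambda>p. B \<notin> set p"] by auto

lemma avoid_from_self [simp]: "avoid_from n B B = 0"
  unfolding avoid_from_def by (auto simp: paths_from_def card_eq_0_iff)

lemma avoid_from_same_level:
  assumes "level P = level B" "P \<noteq> B"
  shows "avoid_from n B P = count_from n P"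
proof -
  have "{p \<in> paths_from n P. B \<notin> set p} = paths_from n P"
    using paths_from_levels assms by fastforce
  then show ?thesis by (simp add: avoid_from_def count_from_def)
qed

lemma avoid_from_expand:
  assumes "i + j + int m \<le> level B" "level B \<le> 2 * int n"
  shows "avoid_from n B (i, j) =
           (\<Sum>k\<le>m. (m choose k) * avoid_from n B (i + int k, j + int m - int k))"
proof (rule pascal_expansion[where L = "level B" and F = "\<lambda>i j. avoid_from n B (i, j)"])
  fix i j assume "i + j < level B"
  with assms(2) show "avoid_from n B (i, j) = avoid_from n B (i + 1, j) + avoid_from n B (i, j + 1)"
    by (intro avoid_from_step) auto
qed (fact assms(1))

lemma count_from_expand:
  assumes "i + j + int m \<le> 2 * int n"
  shows "count_from n (i, j) =
           (\<Sum>k\<le>m. (m choose k) * count_from n (i + int k, j + int m - int k))"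
proof (rule pascal_expansion[where L = "2 * int n" and F = "\<lambda>i j. count_from n (i, j)"])
  fix i j assume "i + j < 2 * int n"
  then show "count_from n (i, j) = count_from n (i + 1, j) + count_from n (i, j + 1)"
    by (intro count_from_step) auto
qed (fact assms)

lemma count_from_binomial:
  assumes "i \<le> n" "j \<le> n"
  shows "count_from n (int i, int j) = (2 * n - i - j) choose (n - i)"
proof -
  define m where "m = 2 * n - i - j"
  have m: "int m = 2 * int n - int i - int j" using assms by (simp add: m_def)
  have "count_from n (int i, int j) =
      (\<Sum>k\<le>m. (m choose k) * count_from n (int i + int k, int j + int m - int k))"
    by (rule count_from_expand) (simp add: m)
  also have "\<dots> = (\<Sum>k\<in>{n - i}. (m choose k) * count_from n (int i + int k, int j + int m - int k))"
  proof (rule sum.mono_neutral_right)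
    have "paths_from n (int i + int k, int j + int m - int k) = {}" if "k \<noteq> n - i" for k
      using that assms by (intro paths_from_above) (auto simp: m)
    then show "\<forall>k\<in>{..m} - {n - i}. (m choose k) * count_from n (int i + int k, int j + int m - int k) = 0"
      by (simp add: count_from_def)
  qed (use assms in \<open>auto simp: m_def\<close>)
  also have "\<dots> = m choose (n - i)"
    using assms by (simp add: m of_nat_diff count_from_def paths_from_end)
  finally show ?thesis by (simp add: m_def)
qed

lemma count_from_eq_choose:
  assumes "i \<le> n" "j \<le> n" "m = 2 * n - i - j" "k = n - i" "P = (int i, int j)"
  shows "count_from n P = m choose k"
  using count_from_binomial assms by simp

lemma lattice_paths_eq: "lattice_paths n = paths_from n (0, 0)"
  by (simp add: lattice_paths_def paths_from_def)

text \<open>The number of paths through \<open>A\<close> avoiding \<open>B\<close>, as a function of the starting point,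
  satisfies Pascal's recurrence up to the level of \<open>A\<close>, where only the term at \<open>A\<close> survives. The
  level assumption ensures that the obstruction cannot be met on the way to \<open>A\<close>.\<close>

lemma avoid_count_eq:
  assumes "int a + int b \<le> level B" "level B \<le> 2 * int n"
  shows "avoid_count n B (int a, int b) = ((a + b) choose a) * avoid_from n B (int a, int b)"
proof -
  let ?A = "(int a, int b)"
  define F where "F i j = card {p \<in> paths_from n (i, j). ?A \<in> set p \<and> B \<notin> set p}" for i j
  have "F 0 0 = (\<Sum>k\<le>a + b. ((a + b) choose k) * F (0 + int k) (0 + int (a + b) - int k))"
  proof (rule pascal_expansion[where L = "int (a + b)"])
    fix i j assume l: "i + j < int (a + b)"
    with assms have "(i, j) \<noteq> (int n, int n)" "(i, j) \<noteq> ?A" "(i, j) \<noteq> B" by auto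
    then show "F i j = F (i + 1) j + F i (j + 1)"
      unfolding F_def using card_paths_step[of i j n "\<lambda>p. ?A \<in> set p \<and> B \<notin> set p"] by auto
  qed simp
  also have "\<dots> = (\<Sum>k\<in>{a}. ((a + b) choose k) * F (0 + int k) (0 + int (a + b) - int k))"
  proof (rule sum.mono_neutral_right)
    have "F (int k) (int a + int b - int k) = 0" if "k \<noteq> a" for k
      using that paths_from_levels[of _ n "(int k, int a + int b - int k)" ?A]
      by (auto simp: F_def card_eq_0_iff)
    then show "\<forall>k\<in>{..a + b} - {a}. ((a + b) choose k) * F (0 + int k) (0 + int (a + b) - int k) = 0"
      by auto
  qed auto
  also have "\<dots> = ((a + b) choose a) * F (int a) (int b)" by simp
  also have "F (int a) (int b) = avoid_from n B ?A"
    unfolding F_def avoid_from_def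
    by (rule arg_cong[where f = card]) (use hd_in_set in \<open>fastforce simp: paths_from_def\<close>)
  finally show ?thesis by (simp add: avoid_count_def lattice_paths_eq F_def)
qed


text \<open>On the level of \<open>B\<close> itself, avoiding \<open>B\<close> removes exactly one term of the expansion.\<close>

lemma avoid_from_complement:
  assumes "B = (i + int k, j + int m - int k)" "k \<le> m" "level B \<le> 2 * int n"
  shows "avoid_from n B (i, j) + (m choose k) * count_from n B = count_from n (i, j)"
proof -
  let ?P = "\<lambda>k. (i + int k, j + int m - int k)"
  have "avoid_from n B (i, j) = (\<Sum>l\<in>{..m} - {k}. (m choose l) * avoid_from n B (?P l))"
    using avoid_from_expand[of i j m B n] assms by (simp add: sum.remove[of "{..m}" k])
  also have "\<dots> = (\<Sum>l\<in>{..m} - {k}. (m choose l) * count_from n (?P l))"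
    by (rule sum.cong) (use assms in \<open>auto simp: avoid_from_same_level\<close>)
  finally show ?thesis
    using count_from_expand[of i j m n] assms by (simp add: sum.remove[of "{..m}" k])
qed

section \<open>The three corner points near the origin\<close>

lemma avoid_count_first_steps:
  assumes "1 \<le> level B" "level B \<le> 2 * int n"
  shows "avoid_count n B (1, 0) = avoid_from n B (1, 0)"
    and "avoid_count n B (0, 1) = avoid_from n B (0, 1)"
  using avoid_count_eq[of 1 0 B n] avoid_count_eq[of 0 1 B n] assms by simp_all

lemma avoid_count_diagonal:
  assumes "2 \<le> level B" "level B \<le> 2 * int n"
  shows "avoid_count n B (1, 1) = 2 * avoid_from n B (1, 1)"
  using avoid_count_eq[of 1 1 B n] assms by simp

text \<open>The first step from \<open>(i, j)\<close> leads to \<open>(i + 1, j)\<close>, which is also reached by a north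
  step from \<open>(i + 1, j - 1)\<close>, or to \<open>(i, j + 1)\<close>, which is also reached by an east step from
  \<open>(i - 1, j + 1)\<close>.\<close>

lemma avoid_from_neighbours:
  assumes "(i, j) \<noteq> B" "(i + 1, j - 1) \<noteq> B" "(i - 1, j + 1) \<noteq> B"
    and "i \<le> int n" "j \<le> int n" "(i, j) \<noteq> (int n, int n)"
  shows "avoid_from n B (i, j) \<le> avoid_from n B (i + 1, j - 1) + avoid_from n B (i - 1, j + 1)"
proof -
  have "avoid_from n B (i, j) = avoid_from n B (i + 1, j) + avoid_from n B (i, j + 1)"
    using assms by (intro avoid_from_step)
  moreover have "avoid_from n B (i + 1, j - 1) \<ge> avoid_from n B (i + 1, j)"
    using avoid_from_step[of "i + 1" "j - 1" n B] assms by auto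
  moreover have "avoid_from n B (i - 1, j + 1) \<ge> avoid_from n B (i, j + 1)"
    using avoid_from_step[of "i - 1" "j + 1" n B] assms by auto
  ultimately show ?thesis by linarith
qed

lemma choose_two_below:
  assumes "b < a" "1 \<le> b"
  shows "(a + b - 1) choose a \<le> (a + b - 1) choose (a - 2)"
proof -
  consider "a = b + 1" | "a = b + 2" | "a \<ge> b + 3" using assms by linarith
  then show ?thesis
  proof cases
    case 1
    then show ?thesis using binomial_symmetric[of a "a + b - 1"] assms by simp
  next
    case 2
    then have "(a + b - 1) choose a = (a + b - 1) choose (b - 1)"
      using binomial_symmetric[of a "a + b - 1"] assms by simp
    also have "\<dots> \<le> (a + b - 1) choose b"
      by (rule binomial_mono) (use 2 in auto)
    finally show ?thesis using 2 by simp
  next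
    case 3
    then show ?thesis using assms by (intro binomial_antimono) auto
  qed
qed

text \<open>By Pascal's rule the weight \<open>(a + b choose a)\<close> of \<open>A\<close> splits into the weight of \<open>A\<close> in
  the expansion of \<open>g(1, 0)\<close> and the weight there of its lower right neighbour. The second
  share is passed on to the two neighbours; below the diagonal the upper left one has at least
  that weight (\<open>choose_two_below\<close>).\<close>

lemma dominated_below_diagonal:
  assumes "int a + int b \<le> level B" "level B \<le> 2 * int n" "a \<le> n" "1 \<le> b" "b < a"
    and "B \<noteq> (int a, int b)" "B \<noteq> (int a + 1, int b - 1)" "B \<noteq> (int a - 1, int b + 1)"
  shows "avoid_count n B (int a, int b) \<le> avoid_count n B (1, 0)"
proof -
  define m where "m = a + b - 1"
  define g where "g k = avoid_from n B (1 + int k, int m - int k)" for k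
  have a: "2 \<le> a" using assms by simp
  have pts: "1 + int (a - 1) = int a" "int m - int (a - 1) = int b"
    "1 + int a = int a + 1" "int m - int a = int b - 1"
    "1 + int (a - 2) = int a - 1" "int m - int (a - 2) = int b + 1"
    using a assms by (auto simp: m_def of_nat_diff)
  have distinct: "a - 2 \<noteq> a - 1" "a - 2 \<noteq> a" "a - 1 \<noteq> a" using a by auto
  have "avoid_from n B (int a, int b) = g (a - 1)"
    unfolding g_def pts ..
  have W: "g (a - 1) \<le> g a + g (a - 2)"
    unfolding g_def pts using assms by (intro avoid_from_neighbours) auto
  have "(a + b) choose a = (m choose (a - 1)) + (m choose a)"
    using binomial_Suc_Suc[of m "a - 1"] a assms by (simp add: m_def)
  then have "avoid_count n B (int a, int b) = (m choose (a - 1)) * g (a - 1) + (m choose a) * g (a - 1)"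
    using avoid_count_eq[OF assms(1,2)] \<open>_ = g (a - 1)\<close> by (simp add: algebra_simps)
  also have "(m choose a) * g (a - 1) \<le> (m choose a) * g a + (m choose a) * g (a - 2)"
    using mult_le_mono2[OF W, of "m choose a"] by (simp add: algebra_simps)
  also have "(m choose a) * g (a - 2) \<le> (m choose (a - 2)) * g (a - 2)"
    unfolding m_def using assms by (intro mult_le_mono1 choose_two_below)
  also have "(m choose (a - 1)) * g (a - 1) + ((m choose a) * g a + (m choose (a - 2)) * g (a - 2)) =
      (\<Sum>k\<in>{a - 2, a - 1, a}. (m choose k) * g k)"
    using distinct by simp
  also have "\<dots> \<le> (\<Sum>k\<le>m. (m choose k) * g k)"
    by (rule sum_mono2) (use assms in \<open>auto simp: m_def\<close>)
  also have "\<dots> = avoid_from n B (1, 0)"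
    using avoid_from_expand[of 1 0 m B n] assms by (simp add: g_def m_def of_nat_diff)
  also have "\<dots> = avoid_count n B (1, 0)"
    using avoid_count_first_steps[of B n] assms by simp
  finally show ?thesis by simp
qed

text \<open>As below the diagonal, but now the two neighbours have equal weights in the expansion
  of \<open>2 * g(1, 1)\<close>, and by Pascal's rule, applied twice, that common weight
  is exactly the excess of the weight \<open>2 a choose a\<close> over the weight of \<open>A\<close> there.\<close>

lemma dominated_on_diagonal:
  assumes "2 * int a \<le> level B" "level B \<le> 2 * int n" "a < n" "2 \<le> a"
    and "B \<noteq> (int a, int a)" "B \<noteq> (int a + 1, int a - 1)" "B \<noteq> (int a - 1, int a + 1)"
  shows "avoid_count n B (int a, int a) \<le> avoid_count n B (1, 1)"
proof -
  define m where "m = 2 * a - 2"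
  define g where "g k = avoid_from n B (1 + int k, 1 + int m - int k)" for k
  have pts: "1 + int (a - 1) = int a" "1 + int m - int (a - 1) = int a"
    "1 + int a = int a + 1" "1 + int m - int a = int a - 1"
    "1 + int (a - 2) = int a - 1" "1 + int m - int (a - 2) = int a + 1"
    using assms by (auto simp: m_def of_nat_diff)
  have distinct: "a - 2 \<noteq> a - 1" "a - 2 \<noteq> a" "a - 1 \<noteq> a" using assms by auto
  have "avoid_from n B (int a, int a) = g (a - 1)"
    unfolding g_def pts ..
  have W: "g (a - 1) \<le> g a + g (a - 2)"
    unfolding g_def pts using assms by (intro avoid_from_neighbours) auto
  have sym: "m choose (a - 2) = m choose a"
    using binomial_symmetric[of a m] assms by (simp add: m_def)
  obtain c where c: "a = Suc (Suc c)" using assms by (metis add_2_eq_Suc le_Suc_ex)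
  moreover from c have "a + a = Suc (Suc m)" by (simp add: m_def)
  ultimately have "(a + a) choose a = 2 * (m choose (a - 1)) + (m choose (a - 2)) + (m choose a)"
    by simp
  then have "(a + a) choose a = 2 * (m choose (a - 1)) + 2 * (m choose a)"
    using sym by simp
  then have "avoid_count n B (int a, int a) =
      2 * ((m choose (a - 1)) * g (a - 1)) + 2 * ((m choose a) * g (a - 1))"
    using avoid_count_eq[of a a B n] assms \<open>_ = g (a - 1)\<close> by (simp add: algebra_simps)
  also have "(m choose a) * g (a - 1) \<le> (m choose a) * g a + (m choose a) * g (a - 2)"
    using mult_le_mono2[OF W, of "m choose a"] by (simp add: algebra_simps)
  also have "2 * ((m choose (a - 1)) * g (a - 1)) + 2 * ((m choose a) * g a + (m choose a) * g (a - 2)) =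
      2 * (\<Sum>k\<in>{a - 2, a - 1, a}. (m choose k) * g k)"
    using distinct sym by simp
  also have "(\<Sum>k\<in>{a - 2, a - 1, a}. (m choose k) * g k) \<le> (\<Sum>k\<le>m. (m choose k) * g k)"
    by (rule sum_mono2) (use assms in \<open>auto simp: m_def\<close>)
  also have "\<dots> = avoid_from n B (1, 1)"
    using avoid_from_expand[of 1 1 m B n] assms by (simp add: g_def m_def of_nat_diff)
  also have "2 * \<dots> = avoid_count n B (1, 1)"
    using avoid_count_diagonal[of B n] assms by simp
  finally show ?thesis by simp
qed

lemma dominated_on_axis:
  assumes "int a \<le> level B" "level B \<le> 2 * int n" "1 \<le> a"
  shows "avoid_count n B (int a, 0) \<le> avoid_count n B (1, 0)"
proof -
  let ?g = "\<lambda>k. (a - 1 choose k) * avoid_from n B (1 + int k, int (a - 1) - int k)"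
  have "avoid_count n B (int a, 0) = ?g (a - 1)"
    using avoid_count_eq[of a 0 B n] assms by (simp add: of_nat_diff)
  also have "\<dots> \<le> (\<Sum>k\<le>a - 1. ?g k)"
    by (rule member_le_sum) auto
  also have "\<dots> = avoid_from n B (1, 0)"
    using avoid_from_expand[of 1 0 "a - 1" B n] assms by (simp add: of_nat_diff)
  also have "\<dots> = avoid_count n B (1, 0)"
    using avoid_count_first_steps[of B n] assms by simp
  finally show ?thesis .
qed

section \<open>Symmetries of the grid\<close>

definition rotate_grid :: "nat \<Rightarrow> int \<times> int \<Rightarrow> int \<times> int" where
  "rotate_grid n P = (int n - fst P, int n - snd P)"

lemma rotate_grid_Pair [simp]: "rotate_grid n (i, j) = (int n - i, int n - j)"
  by (simp add: rotate_grid_def)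

text \<open>The map \<open>\<phi>\<close> on paths may reverse the order of the points, so only the set of visited
  points is required to follow \<open>\<sigma>\<close>.\<close>

lemma avoid_count_transport:
  assumes inv: "\<And>P. \<sigma> (\<sigma> P) = P"
    and paths: "\<And>p. p \<in> lattice_paths n \<Longrightarrow> \<phi> p \<in> lattice_paths n"
    and set: "\<And>p. set (\<phi> p) = \<sigma> ` set p" and phi_inv: "\<And>p. \<phi> (\<phi> p) = p"
  shows "avoid_count n (\<sigma> B) (\<sigma> A) = avoid_count n B A"
proof -
  have mem: "\<sigma> P \<in> set (\<phi> p) \<longleftrightarrow> P \<in> set p" for P p
    unfolding set by (metis image_iff inv)
  have mem': "P \<in> set (\<phi> p) \<longleftrightarrow> \<sigma> P \<in> set p" for P p
    using mem[of "\<sigma> P" p] by (simp add: inv)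
  have "bij_betw \<phi> {p \<in> lattice_paths n. A \<in> set p \<and> B \<notin> set p}
          {p \<in> lattice_paths n. \<sigma> A \<in> set p \<and> \<sigma> B \<notin> set p}"
    by (rule bij_betw_byWitness[where f' = \<phi>]) (auto simp: mem' inv paths phi_inv)
  then show ?thesis unfolding avoid_count_def by (rule bij_betw_same_card[symmetric])
qed

lemma avoid_count_swap:
  "avoid_count n (prod.swap B) (prod.swap A) = avoid_count n B A"
proof (rule avoid_count_transport[where \<sigma> = prod.swap and \<phi> = "map prod.swap"])
  show "prod.swap (prod.swap P) = P" for P :: "int \<times> int" by simp
  show "set (map prod.swap p) = prod.swap ` set p" for p :: "(int \<times> int) list" by simp
  show "map prod.swap (map prod.swap p) = p" for p :: "(int \<times> int) list" by (simp add: comp_def)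
  show "map prod.swap p \<in> lattice_paths n" if "p \<in> lattice_paths n" for p
  proof -
    have "successively (\<lambda>P Q. unit_step (prod.swap P) (prod.swap Q)) p"
      by (rule successively_mono[of unit_step])
        (use that in \<open>auto simp: unit_step_def lattice_paths_def\<close>)
    with that show ?thesis
      by (auto simp: lattice_paths_def successively_map hd_map last_map)
  qed
qed

lemma avoid_count_rotate:
  "avoid_count n (rotate_grid n B) (rotate_grid n A) = avoid_count n B A"
proof (rule avoid_count_transport[where \<sigma> = "rotate_grid n" and \<phi> = "\<lambda>p. rev (map (rotate_grid n) p)"])
  show "rotate_grid n (rotate_grid n P) = P" for P by (simp add: rotate_grid_def)
  then show "rev (map (rotate_grid n) (rev (map (rotate_grid n) p))) = p" for p
    by (simp add: rev_map comp_def)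
  show "set (rev (map (rotate_grid n) p)) = rotate_grid n ` set p" for p by simp
  show "rev (map (rotate_grid n) p) \<in> lattice_paths n" if "p \<in> lattice_paths n" for p
  proof -
    have "successively (\<lambda>P Q. unit_step (rotate_grid n Q) (rotate_grid n P)) p"
      by (rule successively_mono[of unit_step])
        (use that in \<open>auto simp: unit_step_def lattice_paths_def\<close>)
    with that show ?thesis
      by (auto simp: lattice_paths_def successively_map hd_map last_map hd_rev last_rev)
  qed
qed

section \<open>Estimates for central binomial coefficients\<close>

lemma Suc_times_choose_Suc: "Suc k * (n choose Suc k) = (n - k) * (n choose k)"
  by (simp only: binomial_absorption binomial_absorb_comp)

lemma central_binomial_Suc:
  "Suc n * (2 * Suc n choose Suc n) = 2 * (2 * n + 1) * (2 * n choose n)"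
proof -
  have "Suc n * (2 * Suc n choose Suc n) = 2 * (Suc n * (Suc (2 * n) choose n))"
    using binomial_absorption[of n "2 * Suc n"] by simp
  also have "Suc (2 * n) choose n = Suc (2 * n) choose Suc n"
    using binomial_symmetric[of n "Suc (2 * n)"] by (simp add: mult_2 Suc_diff_le)
  also have "Suc n * \<dots> = (2 * n + 1) * (2 * n choose n)"
    using binomial_absorption[of n "Suc (2 * n)"] by simp
  finally show ?thesis by simp
qed

lemma central_binomial_half:
  assumes "1 \<le> m"
  shows "2 * ((2 * m - 1) choose m) = 2 * m choose m"
    and "2 * ((2 * m - 1) choose (m - 1)) = 2 * m choose m"
proof -
  have "2 * m choose m = ((2 * m - 1) choose (m - 1)) + ((2 * m - 1) choose m)"
    using binomial_Suc_Suc[of "2 * m - 1" "m - 1"] assms by simp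
  moreover have "(2 * m - 1) choose (m - 1) = (2 * m - 1) choose m"
    using binomial_symmetric[of m "2 * m - 1"] assms by (simp add: mult_2)
  ultimately show "2 * ((2 * m - 1) choose m) = 2 * m choose m"
    and "2 * ((2 * m - 1) choose (m - 1)) = 2 * m choose m" by simp_all
qed

text \<open>The case \<open>n = 2 k\<close> of the product estimate. Its induction step is a comparison of two
  quartic polynomials with the same leading coefficient; it starts at \<open>k = 5\<close>, since smaller
  \<open>k\<close> would give \<open>n < 9\<close>.\<close>

lemma central_binomial_balanced:
  assumes "5 \<le> k"
  shows "(2 * k choose k) * (2 * k choose k) * (3 * k + 1) \<le> (k + 1) * (4 * k choose (2 * k))"
  using assms
proof (induction k rule: dec_induct)
  case base
  show ?case by (simp add: binomial_fact' fact_numeral)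
next
  case (step k)
  define c where "c = real (2 * k choose k)"
  define d where "d = real (4 * k choose (2 * k))"
  define c' where "c' = real (2 * Suc k choose Suc k)"
  define d' where "d' = real (4 * Suc k choose (2 * Suc k))"
  define x where "x = real k"
  have pos: "x \<ge> 5" "c > 0" "d > 0" using step by (simp_all add: x_def c_def d_def)
  have c': "(x + 1) * c' = 2 * (2 * x + 1) * c"
    using arg_cong[OF central_binomial_Suc[of k], of real] unfolding c'_def c_def x_def
    by (simp add: algebra_simps)
  have eq: "4 * Suc k = 2 * Suc (2 * k + 1)" "2 * Suc k = Suc (2 * k + 1)" by simp_all
  have "(2 * x + 2) * d' = 2 * (4 * x + 3) * real (2 * (2 * k + 1) choose (2 * k + 1))"
    using arg_cong[OF central_binomial_Suc[of "2 * k + 1"], of real] unfolding d'_def x_def eq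
    by (simp add: algebra_simps del: binomial_Suc_Suc)
  moreover have "(2 * x + 1) * real (2 * (2 * k + 1) choose (2 * k + 1)) = 2 * (4 * x + 1) * d"
    using arg_cong[OF central_binomial_Suc[of "2 * k"], of real] unfolding d_def x_def
    by (simp add: algebra_simps del: binomial_Suc_Suc)
  ultimately have d': "(2 * x + 1) * (x + 1) * d' = 2 * (4 * x + 3) * (4 * x + 1) * d"
    by algebra
  have IH: "c * c * (3 * x + 1) \<le> (x + 1) * d"
    using step.IH unfolding c_def d_def x_def
    by (metis (mono_tags, opaque_lifting) of_nat_1 of_nat_add of_nat_le_iff of_nat_mult of_nat_numeral)
  have poly: "2 * (2 * x + 1) ^ 3 * (3 * x + 4) \<le> (4 * x + 3) * (4 * x + 1) * (x + 2) * (3 * x + 1)"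
  proof -
    have "(4 * x + 3) * (4 * x + 1) * (x + 2) * (3 * x + 1) - 2 * (2 * x + 1) ^ 3 * (3 * x + 4) =
        24 * x ^ 3 + 21 * x ^ 2 - x - 2"
      by (simp add: algebra_simps power2_eq_square power3_eq_cube)
    moreover have "x ^ 2 \<ge> x" using pos by (simp add: power2_eq_square)
    moreover have "x ^ 3 \<ge> 0" using pos by simp
    ultimately show ?thesis using pos by linarith
  qed
  define e where "e = 3 * x + 1"
  have "(x + 1)\<^sup>2 * (2 * x + 1) * e * (c' * c' * (3 * x + 4)) =
      ((x + 1) * c') ^ 2 * (2 * x + 1) * e * (3 * x + 4)"
    by (simp add: power2_eq_square)
  also have "\<dots> = 4 * (2 * x + 1) ^ 3 * (3 * x + 4) * (c * c * e)"
    unfolding c' by (simp add: power2_eq_square power3_eq_cube algebra_simps)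
  also have "\<dots> \<le> 4 * (2 * x + 1) ^ 3 * (3 * x + 4) * ((x + 1) * d)"
    using IH pos unfolding e_def by (intro mult_left_mono) auto
  also have "\<dots> = (2 * (2 * x + 1) ^ 3 * (3 * x + 4)) * (2 * (x + 1) * d)"
    by simp
  also have "\<dots> \<le> ((4 * x + 3) * (4 * x + 1) * (x + 2) * (3 * x + 1)) * (2 * (x + 1) * d)"
    using pos by (intro mult_right_mono[OF poly]) auto
  also have "\<dots> = (x + 1) * (x + 2) * e * (2 * (4 * x + 3) * (4 * x + 1) * d)"
    unfolding e_def by (simp only: ac_simps)
  also have "\<dots> = (x + 1)\<^sup>2 * (2 * x + 1) * e * ((x + 2) * d')"
    using d' by algebra
  finally have "c' * c' * (3 * x + 4) \<le> (x + 2) * d'"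
    using pos by (simp add: e_def)
  then have "real ((2 * Suc k choose Suc k) * (2 * Suc k choose Suc k) * (3 * Suc k + 1))
      \<le> real ((Suc k + 1) * (4 * Suc k choose (2 * Suc k)))"
    unfolding c'_def d'_def x_def of_nat_mult by (simp add: algebra_simps del: binomial_Suc_Suc)
  then show ?case by (simp only: of_nat_le_iff)
qed

text \<open>For fixed \<open>k\<close> the quotient of the two sides decreases in \<open>n\<close>, so the smallest admissible
  \<open>n\<close>, which is \<open>2 k\<close> or \<open>9\<close>, is decisive. For \<open>k = 2\<close> the inequality amounts to
  \<open>n\<^sup>2 - 9 n + 6 \<ge> 0\<close>; this is where \<open>n \<ge> 9\<close> comes from.\<close>

lemma central_binomial_product:
  assumes "2 \<le> k" "2 * k \<le> n" "9 \<le> n"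
  shows "(2 * k choose k) * (2 * (n - k) choose (n - k)) * (3 * k + 1) \<le> (k + 1) * (2 * n choose n)"
proof -
  have "max 9 (2 * k) \<le> n" using assms by simp
  then show ?thesis
  proof (induction n rule: dec_induct)
    case base
    show ?case
    proof (cases "5 \<le> k")
      case True
      then show ?thesis
        using central_binomial_balanced[OF True] by (simp add: max_def)
    next
      case False
      then have "k = 2 \<or> k = 3 \<or> k = 4" using assms by auto
      then show ?thesis by (auto simp: max_def binomial_fact' fact_numeral)
    qed
  next
    case (step n)
    define m where "m = n - k"
    have n: "n = k + m" "Suc n - k = Suc m" using step by (auto simp: m_def)
    define x where "x = real k"
    define y where "y = real m"
    define c where "c = real (2 * k choose k) * (3 * x + 1)"
    define d where "d = real (2 * m choose m)"
    define d' where "d' = real (2 * Suc m choose Suc m)"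
    define t where "t = real (2 * n choose n)"
    define t' where "t' = real (2 * Suc n choose Suc n)"
    have pos: "x \<ge> 0" "y \<ge> 0" "c \<ge> 0" "d \<ge> 0" "t \<ge> 0"
      by (simp_all add: x_def y_def c_def d_def t_def)
    have d': "(y + 1) * d' = 2 * (2 * y + 1) * d"
      using arg_cong[OF central_binomial_Suc[of m], of real] unfolding d'_def d_def y_def
      by (simp add: algebra_simps)
    have t': "(x + y + 1) * t' = 2 * (2 * (x + y) + 1) * t"
      using arg_cong[OF central_binomial_Suc[of n], of real] unfolding t'_def t_def x_def y_def n
      by (simp add: algebra_simps)
    have "real ((2 * k choose k) * (2 * (n - k) choose (n - k)) * (3 * k + 1)) \<le> real ((k + 1) * (2 * n choose n))"
      using step.IH by (simp only: of_nat_le_iff)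
    then have IH: "c * d \<le> (x + 1) * t"
      unfolding c_def d_def t_def x_def m_def by (simp add: algebra_simps)
    have "(y + 1) * (x + y + 1) * (c * d') = (x + y + 1) * (2 * (2 * y + 1)) * (c * d)"
      using d' by algebra
    also have "\<dots> \<le> (x + y + 1) * (2 * (2 * y + 1)) * ((x + 1) * t)"
      using IH pos by (intro mult_left_mono) auto
    also have "\<dots> \<le> (y + 1) * (2 * (2 * (x + y) + 1)) * ((x + 1) * t)"
      using pos by (intro mult_right_mono) (auto simp: algebra_simps)
    also have "\<dots> = (y + 1) * (x + y + 1) * ((x + 1) * t')"
      using t' by algebra
    finally have "c * d' \<le> (x + 1) * t'" using pos by (simp add: mult_le_cancel_left_pos add_nonneg_pos)
    then have "real ((2 * k choose k) * (2 * (Suc n - k) choose (Suc n - k)) * (3 * k + 1)) \<le> real ((k + 1) * (2 * Suc n choose Suc n))"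
      unfolding n(2) c_def d'_def t'_def x_def of_nat_mult by (simp add: algebra_simps del: binomial_Suc_Suc)
    then show ?case by (simp only: of_nat_le_iff)
  qed
qed

text \<open>Left: the paths through \<open>(k, k)\<close>, and those through \<open>(1, 0)\<close> and \<open>(k - 1, k + 1)\<close>.
  Right: all paths through \<open>(1, 0)\<close>.\<close>

lemma diagonal_point_bound:
  assumes "2 \<le> k" "2 * k \<le> n" "9 \<le> n"
  shows "(2 * k choose k) * (2 * (n - k) choose (n - k)) +
           ((2 * k - 1) choose (k - 2)) * (2 * (n - k) choose (n - k + 1)) \<le> (2 * n - 1) choose (n - 1)"
proof -
  define e where "e = (2 * k - 1) choose (k - 2)"
  define c where "c = 2 * k choose k"
  define d where "d = 2 * (n - k) choose (n - k)"
  have "(k + 1) * ((2 * k - 1) choose Suc k) = (k - 1) * ((2 * k - 1) choose k)"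
    using Suc_times_choose_Suc[of k "2 * k - 1"] by (simp add: mult_2)
  moreover have "(2 * k - 1) choose Suc k = e"
    using binomial_symmetric[of "Suc k" "2 * k - 1"] assms
    by (simp add: e_def mult_2 numeral_2_eq_2)
  moreover have "2 * ((2 * k - 1) choose k) = c"
    using central_binomial_half(1)[of k] assms by (simp add: c_def)
  ultimately have e: "2 * (k + 1) * e = (k - 1) * c"
    by (metis mult.assoc mult.left_commute)
  have "2 * (k + 1) * (c * d + e * (2 * (n - k) choose (n - k + 1)))
      \<le> 2 * (k + 1) * (c * d + e * d)"
    unfolding d_def by (intro mult_le_mono2 add_left_mono binomial_maximum')
  also have "\<dots> = 2 * (k + 1) * (c * d) + (2 * (k + 1) * e) * d"
    by (simp add: algebra_simps)
  also have "\<dots> = c * d * (3 * k + 1)"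
  proof -
    obtain j where "k = Suc j" using assms by (cases k) auto
    then show ?thesis unfolding e by (simp add: algebra_simps)
  qed
  also have "\<dots> \<le> (k + 1) * (2 * n choose n)"
    unfolding c_def d_def by (rule central_binomial_product[OF assms])
  also have "\<dots> = 2 * (k + 1) * ((2 * n - 1) choose (n - 1))"
    using central_binomial_half(2)[of n] assms by simp
  finally show ?thesis
    by (simp only: c_def d_def e_def mult_le_cancel1) simp
qed

text \<open>Left: the paths through \<open>(k + 1, k)\<close>, and those through \<open>(1, 0)\<close> and \<open>(k, k + 1)\<close>.
  Right: all paths through \<open>(1, 0)\<close>.\<close>

lemma mirror_point_bound:
  assumes "2 \<le> k" "2 * k + 1 \<le> n" "9 \<le> n"
  shows "((2 * k + 1) choose k) * ((2 * (n - k) - 1) choose (n - k - 1)) +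
           (2 * k choose (k - 1)) * ((2 * (n - k) - 1) choose (n - k)) \<le> (2 * n - 1) choose (n - 1)"
proof -
  define c where "c = 2 * k choose k"
  define h where "h = (2 * (n - k) - 1) choose (n - k)"
  have h: "2 * h = 2 * (n - k) choose (n - k)" "(2 * (n - k) - 1) choose (n - k - 1) = h"
    using central_binomial_half[of "n - k"] assms by (force simp: h_def)+
  have "(k + 1) * ((2 * k + 1) choose Suc k) = (2 * k + 1) * c"
    using binomial_absorption[of k "2 * k + 1"] by (simp add: c_def)
  moreover have "(2 * k + 1) choose Suc k = (2 * k + 1) choose k"
    using binomial_symmetric[of k "2 * k + 1"] by (simp add: mult_2 Suc_diff_le)
  ultimately have a: "(k + 1) * ((2 * k + 1) choose k) = (2 * k + 1) * c" by simp
  have "(k + 1) * (2 * k choose Suc k) = k * c"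
    using Suc_times_choose_Suc[of k "2 * k"] by (simp add: c_def)
  moreover have "2 * k choose Suc k = 2 * k choose (k - 1)"
    using binomial_symmetric[of "Suc k" "2 * k"] assms by (simp add: mult_2)
  ultimately have b: "(k + 1) * (2 * k choose (k - 1)) = k * c" by simp
  have "2 * (k + 1) * (((2 * k + 1) choose k) * h + (2 * k choose (k - 1)) * h) =
      ((k + 1) * ((2 * k + 1) choose k) + (k + 1) * (2 * k choose (k - 1))) * (2 * h)"
    by (simp add: algebra_simps)
  also have "\<dots> = c * (2 * (n - k) choose (n - k)) * (3 * k + 1)"
    unfolding a b h by (simp add: algebra_simps)
  also have "\<dots> \<le> (k + 1) * (2 * n choose n)"
    unfolding c_def using assms by (intro central_binomial_product) auto
  also have "\<dots> = 2 * (k + 1) * ((2 * n - 1) choose (n - 1))"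
    using central_binomial_half(2)[of n] assms by simp
  finally show ?thesis
    unfolding h(2) h_def[symmetric] by (simp only: mult_le_cancel1) simp
qed

section \<open>Reduction to diagonally adjacent points\<close>

text \<open>A is harmless for the theorem if some corner does at least as well. Stated with all six
  corners, this notion is invariant under both symmetries, so each case below may be put into
  its most convenient position.\<close>

definition dominated :: "nat \<Rightarrow> int \<times> int \<Rightarrow> int \<times> int \<Rightarrow> bool" where
  "dominated n B A \<longleftrightarrow> (\<exists>C \<in> corner_points n. avoid_count n B A \<le> avoid_count n B C)"

lemma dominatedI:
  "C \<in> corner_points n \<Longrightarrow> avoid_count n B A \<le> avoid_count n B C \<Longrightarrow> dominated n B A"
  by (auto simp: dominated_def)

lemma dominated_corner: "A \<in> corner_points n \<Longrightarrow> dominated n B A"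
  by (auto simp: dominated_def)

lemma near_corners [simp]:
  "(1, 0) \<in> corner_points n" "(0, 1) \<in> corner_points n" "(1, 1) \<in> corner_points n"
  by (auto simp: corner_points_def)

lemma dominated_swap: "dominated n (prod.swap B) (prod.swap A) \<longleftrightarrow> dominated n B A"
proof -
  have "dominated n (prod.swap B) (prod.swap A)" if dom: "dominated n B A" for A B
  proof -
    obtain C where "C \<in> corner_points n" "avoid_count n B A \<le> avoid_count n B C"
      using dom unfolding dominated_def by blast
    then show ?thesis
      by (intro dominatedI[of "prod.swap C"]) (auto simp: avoid_count_swap corner_points_def)
  qed
  from this[of B A] this[of "prod.swap B" "prod.swap A"] show ?thesis by auto
qed

lemma rotate_grid_rotate_grid [simp]: "rotate_grid n (rotate_grid n P) = P"
  by (simp add: rotate_grid_def)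

lemma dominated_rotate: "dominated n (rotate_grid n B) (rotate_grid n A) \<longleftrightarrow> dominated n B A"
proof -
  have "dominated n (rotate_grid n B) (rotate_grid n A)" if dom: "dominated n B A" for A B
  proof -
    obtain C where "C \<in> corner_points n" "avoid_count n B A \<le> avoid_count n B C"
      using dom unfolding dominated_def by blast
    then show ?thesis
      by (intro dominatedI[of "rotate_grid n C"]) (auto simp: avoid_count_rotate corner_points_def)
  qed
  from this[of B A] this[of "rotate_grid n B" "rotate_grid n A"] show ?thesis by auto
qed

lemma avoid_count_self [simp]: "avoid_count n B B = 0"
  by (simp add: avoid_count_def)

lemma dominated_low_half:
  assumes "int a + int b \<le> level B" "level B \<le> 2 * int n" "a \<le> n" "b \<le> a" "0 < a" "b < n"
    and "B \<noteq> (int a + 1, int b - 1)" "B \<noteq> (int a - 1, int b + 1)"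
  shows "dominated n B (int a, int b)"
proof -
  consider "B = (int a, int b)" | "b = 0" | "B \<noteq> (int a, int b)" "1 \<le> b" "b < a"
    | "B \<noteq> (int a, int b)" "a = b" "2 \<le> a" | "a = 1" "b = 1"
    using assms by linarith
  then show ?thesis
  proof cases
    case 1
    then show ?thesis by (intro dominatedI[of "(1, 0)"]) auto
  next
    case 2
    then show ?thesis
      using assms dominated_on_axis[of a B n] by (intro dominatedI[of "(1, 0)"]) auto
  next
    case 3
    then show ?thesis
      using assms dominated_below_diagonal[of a b B n] by (intro dominatedI[of "(1, 0)"]) auto
  next
    case 4
    then show ?thesis
      using assms dominated_on_diagonal[of a B n] by (intro dominatedI[of "(1, 1)"]) auto
  next
    case 5
    then show ?thesis by (simp add: dominated_corner)
  qed
qed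

lemma inner_gridE:
  assumes "A \<in> inner_grid n"
  obtains a b where "A = (int a, int b)" "a \<le> n" "b \<le> n" "0 < a + b" "a + b < 2 * n"
proof -
  obtain x y where A: "A = (x, y)" by fastforce
  show ?thesis
    by (rule that[of "nat x" "nat y"]) (use assms A in \<open>auto simp: inner_grid_def grid_def\<close>)
qed

lemma inner_grid_level:
  "A \<in> inner_grid n \<Longrightarrow> 1 \<le> level A \<and> level A < 2 * int n"
  by (erule inner_gridE) auto

lemma dominated_low:
  assumes "A \<in> inner_grid n" "B \<in> inner_grid n" "level A \<le> level B"
    and "B \<noteq> (fst A + 1, snd A - 1)" "B \<noteq> (fst A - 1, snd A + 1)"
  shows "dominated n B A"
proof -
  obtain a b where A: "A = (int a, int b)" "a \<le> n" "b \<le> n" "0 < a + b" "a + b < 2 * n"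
    using assms(1) by (rule inner_gridE)
  have B: "level B \<le> 2 * int n" using inner_grid_level[OF assms(2)] by simp
  show ?thesis
  proof (cases "b \<le> a")
    case True
    then show ?thesis using assms A B by (auto intro!: dominated_low_half)
  next
    case False
    have "dominated n (prod.swap B) (int b, int a)"
      using False assms A B
      by (intro dominated_low_half) (auto simp: level_def prod.swap_def prod_eq_iff)
    then show ?thesis using dominated_swap[of n B A] A by simp
  qed
qed

section \<open>Points diagonally adjacent to the obstruction\<close>

text \<open>Two different points of one level never lie on a common path, so the obstruction costs
  nothing here.\<close>

lemma avoid_count_same_level:
  assumes "int a + int b = level B" "B \<noteq> (int a, int b)" "a \<le> n" "b \<le> n"
  shows "avoid_count n B (int a, int b) = ((a + b) choose a) * ((2 * n - a - b) choose (n - a))"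
  using assms avoid_count_eq[of a b B n] avoid_from_same_level[of "(int a, int b)" B n]
  by (simp add: count_from_binomial)

text \<open>The points \<open>A\<close>, its reflection and \<open>B\<close> lie on one level, so the three families of
  paths through them are disjoint. The first two are equally large and avoid \<open>B\<close>, while every
  path avoiding \<open>B\<close> starts with a step to \<open>(1, 0)\<close> or to \<open>(0, 1)\<close>.\<close>

lemma mirrored_pair_bound:
  assumes "int a + int b = level B" "1 \<le> level B" "level B < 2 * int n" "a \<le> n" "b \<le> n"
    and "a \<noteq> b" "B \<noteq> (int a, int b)" "B \<noteq> (int b, int a)"
  shows "2 * avoid_count n B (int a, int b) \<le> avoid_count n B (1, 0) + avoid_count n B (0, 1)"
proof -
  let ?t = "\<lambda>k. (a + b choose k) * avoid_from n B (int k, int (a + b) - int k)"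
  have "avoid_count n B (int b, int a) = avoid_count n B (int a, int b)"
    using assms binomial_symmetric[of a "a + b"] binomial_symmetric[of "n - a" "2 * n - a - b"]
    by (simp add: avoid_count_same_level add.commute diff_commute)
  moreover have "int (a + b) - int a = int b" "int (a + b) - int b = int a" by simp_all
  moreover have "avoid_count n B (int a, int b) = (a + b choose a) * avoid_from n B (int a, int b)"
    by (rule avoid_count_eq) (use assms in auto)
  moreover have "avoid_count n B (int b, int a) = (b + a choose b) * avoid_from n B (int b, int a)"
    by (rule avoid_count_eq) (use assms in auto)
  ultimately have "avoid_count n B (int a, int b) = ?t a" "avoid_count n B (int a, int b) = ?t b"
    by (simp_all only: add.commute[of b a])
  then have "2 * avoid_count n B (int a, int b) = (\<Sum>k\<in>{a, b}. ?t k)"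
    using \<open>a \<noteq> b\<close> by (simp only: sum.insert sum.empty finite.intros insert_iff empty_iff) simp
  also have "\<dots> \<le> (\<Sum>k\<le>a + b. ?t k)"
    by (rule sum_mono2) auto
  also have "\<dots> = avoid_from n B (0, 0)"
    using avoid_from_expand[of 0 0 "a + b" B n] assms by simp
  also have "\<dots> = avoid_from n B (1, 0) + avoid_from n B (0, 1)"
  proof -
    have "B \<noteq> (0, 0)" "n \<noteq> 0" using assms(2,3) by auto
    then show ?thesis using avoid_from_step[of 0 0 n B] by auto
  qed
  finally show ?thesis using avoid_count_first_steps[of B n] assms by simp
qed

lemma dominated_mirrored_pair:
  assumes "int a + int b = level B" "1 \<le> level B" "level B < 2 * int n" "a \<le> n" "b \<le> n"
    and "a \<noteq> b" "B \<noteq> (int a, int b)" "B \<noteq> (int b, int a)"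
  shows "dominated n B (int a, int b)"
proof (cases "avoid_count n B (int a, int b) \<le> avoid_count n B (1, 0)")
  case True
  then show ?thesis by (intro dominatedI[of "(1, 0)"]) auto
next
  case False
  then show ?thesis
    using mirrored_pair_bound[OF assms] by (intro dominatedI[of "(0, 1)"]) auto
qed

text \<open>Here the reflection of \<open>A\<close> is \<open>A\<close> itself, so disjointness of path families is not enough
  and the counts have to be compared: among the paths through \<open>(1, 0)\<close>, those that avoid \<open>B\<close>
  are obtained by subtraction.\<close>

lemma dominated_diagonal_low:
  assumes "1 \<le> k" "2 * k \<le> n" "9 \<le> n"
  shows "dominated n (int k - 1, int k + 1) (int k, int k)"
proof (cases "k = 1")
  case True
  then show ?thesis by (simp add: dominated_corner)
next
  case False
  let ?B = "(int k - 1, int k + 1)"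
  have cnt: "count_from n ?B = 2 * (n - k) choose (n - k + 1)"
    by (rule count_from_eq_choose[where i = "k - 1" and j = "k + 1"])
      (use assms in auto)
  have compl: "avoid_from n ?B (1, 0) + ((2 * k - 1) choose (k - 2)) * count_from n ?B = count_from n (1, 0)"
    by (rule avoid_from_complement) (use False assms in auto)
  have tot: "count_from n (1, 0) = (2 * n - 1) choose (n - 1)"
    using count_from_binomial[of 1 n 0] assms by simp
  have A: "avoid_count n ?B (int k, int k) = (2 * k choose k) * (2 * (n - k) choose (n - k))"
  proof -
    have "avoid_count n ?B (int k, int k) = ((k + k) choose k) * ((2 * n - k - k) choose (n - k))"
      by (rule avoid_count_same_level) (use assms in auto)
    moreover have "k + k = 2 * k" "2 * n - k - k = 2 * (n - k)" by simp_all
    ultimately show ?thesis by (simp only:)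
  qed
  have C: "avoid_count n ?B (1, 0) = avoid_from n ?B (1, 0)"
    by (rule avoid_count_first_steps) (use assms in auto)
  have "avoid_count n ?B (int k, int k) \<le> avoid_count n ?B (1, 0)"
    using diagonal_point_bound[of k n] compl False assms unfolding A C cnt tot by linarith
  then show ?thesis by (intro dominatedI[of "(1, 0)"]) auto
qed

text \<open>Here the reflection of \<open>A\<close> is \<open>B\<close>. For \<open>k = 1\<close> this is the special obstruction \<open>(1, 2)\<close>,
  and domination fails.\<close>

lemma dominated_mirror_low:
  assumes "k \<noteq> 1" "2 * k + 1 \<le> n" "9 \<le> n"
  shows "dominated n (int k, int k + 1) (int k + 1, int k)"
proof (cases "k = 0")
  case True
  then show ?thesis by (simp add: dominated_corner)
next
  case False
  let ?B = "(int k, int k + 1)"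
  have cnt: "count_from n ?B = (2 * (n - k) - 1) choose (n - k)"
    by (rule count_from_eq_choose[where i = k and j = "k + 1"]) (use assms in auto)
  have compl: "avoid_from n ?B (1, 0) + (2 * k choose (k - 1)) * count_from n ?B = count_from n (1, 0)"
    by (rule avoid_from_complement) (use False assms in auto)
  have tot: "count_from n (1, 0) = (2 * n - 1) choose (n - 1)"
    using count_from_binomial[of 1 n 0] assms by simp
  have A: "avoid_count n ?B (int k + 1, int k) =
      ((2 * k + 1) choose k) * ((2 * (n - k) - 1) choose (n - k - 1))"
  proof -
    have "avoid_count n ?B (int (k + 1), int k) =
        ((k + 1 + k) choose (k + 1)) * ((2 * n - (k + 1) - k) choose (n - (k + 1)))"
      by (rule avoid_count_same_level) (use assms in auto)
    moreover have "k + 1 + k = 2 * k + 1" "2 * n - (k + 1) - k = 2 * (n - k) - 1"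
      "n - (k + 1) = n - k - 1" "int (k + 1) = int k + 1" by simp_all
    moreover have "(2 * k + 1) choose (k + 1) = (2 * k + 1) choose k"
      using binomial_symmetric[of k "2 * k + 1"] by (simp add: mult_2 Suc_diff_le)
    ultimately show ?thesis by (simp only:)
  qed
  have C: "avoid_count n ?B (1, 0) = avoid_from n ?B (1, 0)"
    by (rule avoid_count_first_steps) (use assms in auto)
  have "avoid_count n ?B (int k + 1, int k) \<le> avoid_count n ?B (1, 0)"
    using mirror_point_bound[of k n] compl False assms unfolding A C cnt tot by linarith
  then show ?thesis by (intro dominatedI[of "(1, 0)"]) auto
qed

lemma dominated_adjacent:
  assumes "9 \<le> n" "1 \<le> a" "a \<le> n" "b < n"
    and "(int a - 1, int b + 1) \<in> special_points n \<Longrightarrow> a \<noteq> b + 1"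
  shows "dominated n (int a - 1, int b + 1) (int a, int b)"
proof -
  let ?B = "(int a - 1, int b + 1)"
  consider "a = b" "2 * a \<le> n" | "a = b" "n < 2 * a" | "a = b + 1" "2 * b + 1 \<le> n"
    | "a = b + 1" "n < 2 * b + 1" | "a \<noteq> b" "a \<noteq> b + 1" by linarith
  then show ?thesis
  proof cases
    case 1
    then show ?thesis using dominated_diagonal_low[of a n] assms by simp
  next
    case 2
    then have "dominated n (int (n - a) - 1, int (n - a) + 1) (int (n - a), int (n - a))"
      using assms by (intro dominated_diagonal_low) auto
    moreover have "prod.swap (rotate_grid n ?B) = (int (n - a) - 1, int (n - a) + 1)"
      "prod.swap (rotate_grid n (int a, int b)) = (int (n - a), int (n - a))"
      using 2 assms by (simp_all add: of_nat_diff)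
    ultimately show ?thesis
      by (metis dominated_rotate dominated_swap)
  next
    case 3
    then have "b \<noteq> 1" using assms(5) by (auto simp: special_points_def)
    with 3 show ?thesis using dominated_mirror_low[of b n] assms by (simp add: add.commute)
  next
    case 4
    define k where "k = n - b - 1"
    have k: "int k = int n - int b - 1" using assms by (simp add: k_def of_nat_diff)
    have "k \<noteq> 1" using assms(5) 4 k by (auto simp: special_points_def)
    then have "dominated n (int k, int k + 1) (int k + 1, int k)"
      using 4 assms by (intro dominated_mirror_low) (auto simp: k_def)
    moreover have "prod.swap (rotate_grid n ?B) = (int k, int k + 1)"
      "prod.swap (rotate_grid n (int a, int b)) = (int k + 1, int k)"
      using 4 by (simp_all add: k)
    ultimately show ?thesis
      by (metis dominated_rotate dominated_swap)
  next
    case 5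
    then show ?thesis using assms by (intro dominated_mirrored_pair) auto
  qed
qed

lemma special_points_swap: "prod.swap P \<in> special_points n \<longleftrightarrow> P \<in> special_points n"
  by (cases P) (auto simp: special_points_def)

lemma dominated_unless_special:
  assumes "9 \<le> n" "A \<in> inner_grid n" "B \<in> inner_grid n"
    and "B \<in> special_points n \<Longrightarrow> A \<noteq> prod.swap B"
  shows "dominated n B A"
proof -
  obtain a b where A: "A = (int a, int b)" "a \<le> n" "b \<le> n" "0 < a + b" "a + b < 2 * n"
    using assms(2) by (rule inner_gridE)
  obtain c d where B: "B = (int c, int d)" "c \<le> n" "d \<le> n" "0 < c + d" "c + d < 2 * n"
    using assms(3) by (rule inner_gridE)
  consider "B = (int a - 1, int b + 1)" | "B = (int a + 1, int b - 1)"
    | "B \<noteq> (int a - 1, int b + 1)" "B \<noteq> (int a + 1, int b - 1)" by blast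
  then show ?thesis
  proof cases
    case 1
    then have "dominated n (int a - 1, int b + 1) (int a, int b)"
      using assms A B by (intro dominated_adjacent) auto
    then show ?thesis using 1 A by simp
  next
    case 2
    then have "dominated n (int b - 1, int a + 1) (int b, int a)"
      using assms A B special_points_swap[of B n] by (intro dominated_adjacent) auto
    then show ?thesis using dominated_swap[of n B A] 2 A by simp
  next
    case 3
    show ?thesis
    proof (cases "level A \<le> level B")
      case True
      then show ?thesis using 3 A assms by (intro dominated_low) auto
    next
      case False
      have "dominated n (rotate_grid n B) (rotate_grid n A)"
        using False 3 A B by (intro dominated_low) (auto simp: inner_grid_def grid_def)
      then show ?thesis by (simp add: dominated_rotate)
    qed
  qed
qed

section \<open>The four special obstructions\<close>

text \<open>With \<open>q = n - 2\<close>, all counts become linear combinations of the four neighbouring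
  binomial coefficients \<open>z\<close>, \<open>w\<close>, \<open>u\<close>, \<open>e\<close>, and \<open>0 < u < w < z = 2 e\<close> suffices. For the
  corners near \<open>(n, n)\<close> the picture is rotated, which moves the obstruction to
  \<open>(n - 1, n - 2)\<close> and the corners to the origin.\<close>

lemma corner_less_mirror_base:
  assumes "9 \<le> n" "C \<in> corner_points n"
  shows "avoid_count n (1, 2) C < avoid_count n (1, 2) (2, 1)"
proof -
  define q where "q = n - 2"
  have n: "n = q + 2" "7 \<le> q" using assms by (auto simp: q_def)
  define z where "z = 2 * q choose q"
  define w where "w = 2 * q choose (q - 1)"
  define u where "u = 2 * q choose (q - 2)"
  define e where "e = (2 * q - 1) choose q"
  have z: "z = 2 * e" using central_binomial_half(1)[of q] n by (simp add: z_def e_def)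
  have uwz: "0 < u" "u < w" "w < z"
    unfolding u_def w_def z_def using n by (auto intro!: binomial_strict_mono)
  have w': "2 * q choose (q + 1) = w"
    using binomial_symmetric[of "q + 1" "2 * q"] n by (simp add: w_def mult_2)
  have pascal: "Suc m = M \<Longrightarrow> Suc k = K \<Longrightarrow> M choose K = (m choose k) + (m choose K)" for m M k K
    by auto
  have "(2 * q + 1) choose (q + 1) = ((2 * q) choose (q)) + ((2 * q) choose (q + 1))"
    by (rule pascal) (use n in auto)
  then have h: "(2 * q + 1) choose (q + 1) = z + w"
    using w' z_def by linarith
  have "(2 * q + 1) choose (q) = ((2 * q) choose (q - 1)) + ((2 * q) choose (q))"
    by (rule pascal) (use n in auto)
  then have h': "(2 * q + 1) choose (q) = z + w"
    using w_def z_def by linarith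
  have "(2 * q + 1) choose (q - 1) = ((2 * q) choose (q - 2)) + ((2 * q) choose (q - 1))"
    by (rule pascal) (use n in auto)
  then have v: "(2 * q + 1) choose (q - 1) = u + w"
    using u_def w_def by linarith
  have "(2 * q + 2) choose (q + 1) = ((2 * q + 1) choose (q)) + ((2 * q + 1) choose (q + 1))"
    by (rule pascal) (use n in auto)
  then have c: "(2 * q + 2) choose (q + 1) = 2 * (z + w)"
    unfolding h h' by (rule trans) simp
  have "(2 * q + 2) choose (q) = ((2 * q + 1) choose (q - 1)) + ((2 * q + 1) choose (q))"
    by (rule pascal) (use n in auto)
  then have c': "(2 * q + 2) choose (q) = z + 2 * w + u"
    unfolding h' v by (rule trans) simp
  have "(2 * q + 3) choose (q + 1) = ((2 * q + 2) choose (q)) + ((2 * q + 2) choose (q + 1))"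
    by (rule pascal) (use n in auto)
  then have t: "(2 * q + 3) choose (q + 1) = 3 * z + 4 * w + u"
    unfolding c c' by (rule trans) simp
  have t': "(2 * q + 3) choose (q + 2) = 3 * z + 4 * w + u"
    using binomial_symmetric[of "q + 1" "2 * q + 3"] t by simp
  let ?B = "(1, 2) :: int \<times> int" and ?R = "(int n - 1, int n - 2)"
  have G0: "count_from n (1, 0) = 3 * z + 4 * w + u"
    unfolding t[symmetric] by (rule count_from_eq_choose[where i = 1 and j = 0]) (use n in auto)
  have G1: "count_from n (0, 1) = 3 * z + 4 * w + u"
    unfolding t'[symmetric] by (rule count_from_eq_choose[where i = 0 and j = 1]) (use n in auto)
  have G2: "count_from n (1, 1) = 2 * (z + w)"
    unfolding c[symmetric] by (rule count_from_eq_choose[where i = 1 and j = 1]) (use n in auto)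
  have G3: "count_from n ?B = z + w"
    unfolding h[symmetric] by (rule count_from_eq_choose[where i = 1 and j = 2]) (use n in auto)
  have G4: "count_from n (2, 1) = z + w"
    unfolding h'[symmetric] by (rule count_from_eq_choose[where i = 2 and j = 1]) (use n in auto)
  have GR: "count_from n ?R = 3"
    using count_from_eq_choose[of "n - 1" n "n - 2" 3 1 ?R] n by (simp add: of_nat_diff)
  have "avoid_count n ?B (2, 1) = (3 choose 2) * avoid_from n ?B (2, 1)"
    using avoid_count_eq[of 2 1 ?B n] n by simp
  then have mirror: "avoid_count n ?B (2, 1) = 3 * (z + w)"
    using avoid_from_same_level[of "(2, 1)" ?B n] G4 by (simp add: eval_nat_numeral)
  have low: "avoid_from n ?B (1, 0) + (z + w) = 3 * z + 4 * w + u"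
    "avoid_from n ?B (0, 1) + 2 * (z + w) = 3 * z + 4 * w + u"
    "avoid_from n ?B (1, 1) + (z + w) = 2 * (z + w)"
    using avoid_from_complement[of ?B 1 0 0 2 n] avoid_from_complement[of ?B 0 1 1 2 n]
      avoid_from_complement[of ?B 1 0 1 1 n] G0 G1 G2 G3 n by simp_all
  have "avoid_from n ?R (1, 0) + (2 * q choose q) * count_from n ?R = count_from n (1, 0)"
    by (rule avoid_from_complement) (use n in auto)
  moreover have "avoid_from n ?R (0, 1) + (2 * q choose (q + 1)) * count_from n ?R = count_from n (0, 1)"
    by (rule avoid_from_complement) (use n in auto)
  moreover have "avoid_from n ?R (1, 1) + ((2 * q - 1) choose q) * count_from n ?R = count_from n (1, 1)"
    by (rule avoid_from_complement) (use n in auto)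
  ultimately have high: "avoid_from n ?R (1, 0) + z * 3 = 3 * z + 4 * w + u"
    "avoid_from n ?R (0, 1) + w * 3 = 3 * z + 4 * w + u"
    "avoid_from n ?R (1, 1) + e * 3 = 2 * (z + w)"
    unfolding GR G0 G1 G2 w' z_def[symmetric] e_def[symmetric] by this+
  have rot: "avoid_count n ?B (int n - i, int n - j) = avoid_count n ?R (i, j)" for i j
    using avoid_count_rotate[of n ?B "(int n - i, int n - j)"] by simp
  have first: "avoid_count n ?B (1, 0) = avoid_from n ?B (1, 0)"
    "avoid_count n ?B (0, 1) = avoid_from n ?B (0, 1)"
    "avoid_count n ?B (1, 1) = 2 * avoid_from n ?B (1, 1)"
    "avoid_count n ?R (1, 0) = avoid_from n ?R (1, 0)"
    "avoid_count n ?R (0, 1) = avoid_from n ?R (0, 1)"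
    "avoid_count n ?R (1, 1) = 2 * avoid_from n ?R (1, 1)"
    using n by (auto intro!: avoid_count_first_steps avoid_count_diagonal)
  have bounds: "avoid_count n ?B (1, 0) < 3 * (z + w)" "avoid_count n ?B (0, 1) < 3 * (z + w)"
    "avoid_count n ?B (1, 1) < 3 * (z + w)"
    "avoid_count n ?B (int n - 1, int n - 0) < 3 * (z + w)"
    "avoid_count n ?B (int n - 0, int n - 1) < 3 * (z + w)"
    "avoid_count n ?B (int n - 1, int n - 1) < 3 * (z + w)"
    unfolding rot first using low high uwz z by simp_all
  \<comment> \<open>The far corners are written with \<open>- 0\<close> so that they match the rotated form in \<open>rot\<close>.\<close>
  have "C = (1, 0) \<or> C = (0, 1) \<or> C = (1, 1) \<or> C = (int n - 1, int n - 0) \<or>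
      C = (int n - 0, int n - 1) \<or> C = (int n - 1, int n - 1)"
    using assms(2) by (auto simp: corner_points_def)
  then show ?thesis
    unfolding mirror by (elim disjE) (simp_all only: bounds)
qed

lemma corner_less_mirror:
  assumes "9 \<le> n" "B \<in> special_points n" "C \<in> corner_points n"
  shows "avoid_count n B C < avoid_count n B (prod.swap B)"
proof -
  let ?\<rho> = "rotate_grid n"
  have C: "prod.swap C \<in> corner_points n" "?\<rho> C \<in> corner_points n" "prod.swap (?\<rho> C) \<in> corner_points n"
    using assms(3) by (auto simp: corner_points_def)
  consider "B = (1, 2)" | "B = prod.swap (1, 2)" | "B = ?\<rho> (1, 2)" | "B = ?\<rho> (prod.swap (1, 2))"
    using assms(2) by (auto simp: special_points_def)
  then show ?thesis
  proof cases
    case 1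
    then show ?thesis using corner_less_mirror_base[OF assms(1,3)] by simp
  next
    case 2
    then show ?thesis
      using corner_less_mirror_base[OF assms(1) C(1)] avoid_count_swap[of n "(1, 2)" "prod.swap C"]
        avoid_count_swap[of n "(1, 2)" "(2, 1)"] by simp
  next
    case 3
    then show ?thesis
      using corner_less_mirror_base[OF assms(1) C(2)] avoid_count_rotate[of n "(1, 2)" "?\<rho> C"]
        avoid_count_rotate[of n "(1, 2)" "(2, 1)"] by simp
  next
    case 4
    then show ?thesis
      using corner_less_mirror_base[OF assms(1) C(3)] avoid_count_rotate[of n "(2, 1)" "?\<rho> C"]
        avoid_count_rotate[of n "(2, 1)" "(1, 2)"] avoid_count_swap[of n "(1, 2)" "prod.swap (?\<rho> C)"]
        avoid_count_swap[of n "(1, 2)" "(2, 1)"] by simp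
  qed
qed

section \<open>The maximum\<close>

lemma finite_inner_grid: "finite (inner_grid n)"
proof -
  have "inner_grid n \<subseteq> {0..int n} \<times> {0..int n}" by (auto simp: inner_grid_def grid_def)
  then show ?thesis by (rule finite_subset) simp
qed

lemma max_attained_iff:
  "max_attained_at n B A \<longleftrightarrow>
     A \<in> inner_grid n \<and> (\<forall>A' \<in> inner_grid n. avoid_count n B A' \<le> avoid_count n B A)"
proof (cases "A \<in> inner_grid n")
  case True
  then have "avoid_count n B A = Max (avoid_count n B ` inner_grid n) \<longleftrightarrow>
      (\<forall>A' \<in> inner_grid n. avoid_count n B A' \<le> avoid_count n B A)"
    by (auto simp: finite_inner_grid intro!: Max_eqI[symmetric])
  then show ?thesis by (simp add: max_attained_at_def True)
qed (simp add: max_attained_at_def)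

lemma corner_points_inner: "9 \<le> n \<Longrightarrow> corner_points n \<subseteq> inner_grid n"
  by (auto simp: corner_points_def inner_grid_def grid_def)

lemma special_points_inner: "9 \<le> n \<Longrightarrow> special_points n \<subseteq> inner_grid n"
  by (auto simp: special_points_def inner_grid_def grid_def)

lemma max_attained_at_mirror:
  assumes "9 \<le> n" "B \<in> special_points n"
  shows "max_attained_at n B (prod.swap B)"
  unfolding max_attained_iff
proof (intro conjI ballI)
  show "prod.swap B \<in> inner_grid n"
    using assms special_points_swap[of B n] special_points_inner by blast
  fix A assume "A \<in> inner_grid n"
  then have "A = prod.swap B \<or> dominated n B A"
    using assms dominated_unless_special special_points_inner by blast
  then show "avoid_count n B A \<le> avoid_count n B (prod.swap B)"
    using corner_less_mirror[OF assms] unfolding dominated_def by fastforce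
qed

lemma max_attained_at_corner:
  assumes "9 \<le> n" "B \<in> inner_grid n" "B \<notin> special_points n"
  obtains C where "C \<in> corner_points n" "max_attained_at n B C"
proof -
  have ne: "finite (corner_points n)" "corner_points n \<noteq> {}" by (auto simp: corner_points_def)
  then have "Max (avoid_count n B ` corner_points n) \<in> avoid_count n B ` corner_points n"
    by (intro Max_in) auto
  then obtain C where "C \<in> corner_points n" and C_max: "Max (avoid_count n B ` corner_points n) = avoid_count n B C"
    by blast
  then have C: "C \<in> corner_points n" "\<And>C'. C' \<in> corner_points n \<Longrightarrow> avoid_count n B C' \<le> avoid_count n B C"
    using ne by (auto simp flip: C_max)
  have "avoid_count n B A \<le> avoid_count n B C" if A: "A \<in> inner_grid n" for A
  proof -
    obtain C' where "C' \<in> corner_points n" "avoid_count n B A \<le> avoid_count n B C'"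
      using dominated_unless_special[OF assms(1) A assms(2)] assms(3) unfolding dominated_def by blast
    with C(2) show ?thesis using le_trans by blast
  qed
  with C corner_points_inner[OF assms(1)] show ?thesis
    by (intro that[of C]) (auto simp: max_attained_iff)
qed

theorem mainTheorem1:
  fixes n :: nat
  assumes "n \<ge> 9"
  shows "(\<forall>B \<in> inner_grid n.
            (\<exists>A \<in> special_points n \<union> corner_points n. max_attained_at n B A) \<and>
            (\<forall>c d. B = (c, d) \<longrightarrow> B \<in> special_points n \<longrightarrow> max_attained_at n B (d, c)) \<and>
            (B \<notin> special_points n \<longrightarrow> (\<exists>A \<in> corner_points n. max_attained_at n B A))) \<and>
         special_points n =
           {B \<in> inner_grid n. \<forall>A \<in> corner_points n. \<not> max_attained_at n B A}"
proof -
  note n = \<open>n \<ge> 9\<close>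
  have not_corner: "\<not> max_attained_at n B A" if "B \<in> special_points n" "A \<in> corner_points n" for A B
    using max_attained_at_mirror[OF n that(1)] corner_less_mirror[OF n that]
    unfolding max_attained_iff by fastforce
  have mirror: "max_attained_at n (c, d) (d, c)" if "(c, d) \<in> special_points n" for c d
    using max_attained_at_mirror[OF n that] by simp
  have mirror_special: "(d, c) \<in> special_points n" if "(c, d) \<in> special_points n" for c d
    using special_points_swap[of "(c, d)" n] that by simp
  show ?thesis
  proof (intro conjI ballI)
    fix B assume B: "B \<in> inner_grid n"
    obtain c d where cd: "B = (c, d)" by fastforce
    show "\<exists>A \<in> special_points n \<union> corner_points n. max_attained_at n B A"
      using mirror mirror_special max_attained_at_corner[OF n B] cd by (metis UnCI)
    show "\<forall>c d. B = (c, d) \<longrightarrow> B \<in> special_points n \<longrightarrow> max_attained_at n B (d, c)"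
      using mirror by blast
    show "B \<notin> special_points n \<longrightarrow> (\<exists>A \<in> corner_points n. max_attained_at n B A)"
      using max_attained_at_corner[OF n B] by metis
  next
    show "special_points n = {B \<in> inner_grid n. \<forall>A \<in> corner_points n. \<not> max_attained_at n B A}"
      using not_corner special_points_inner[OF n] max_attained_at_corner[OF n] by blast
  qed
qed

end
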